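(* For $\theta=\frac{\pi}{3}$, that is, for $\rho=\cos\theta=\frac12$, there is no genuine pair.
   Context: A rational triangle is a triangle with rational side lengths (its area need not be rational). For $\rho\in\mathbb{Q}\cap(-1,1)$ let $\theta\in(0,\pi)$ be the angle with $\cos\theta=\rho$. A genuine pair for $\rho$ is a pair $(T,I)$ of non-degenerate rational triangles such that $T$ has an angle equal to $\theta$, $I$ is isosceles, $T$ and $I$ have the same perimeter and the same area, and $T$ and $I$ are not congruent. *)

theory Defs
  imports "HOL-Analysis.Analysis"
begin

text \<open>A triangle is given by its three vertices in the Euclidean plane; the solid triangle is the
  convex hull of the vertices.\<close>

type_synonym triangle = "(real ^ 2) \<times> (real ^ 2) \<times> (real ^ 2)"

definition nondegenerate :: "triangle \<Rightarrow> bool" where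
  "nondegenerate = (\<lambda>(A, B, C). \<not> collinear {A, B, C})"

definition rational_sides :: "triangle \<Rightarrow> bool" where
  "rational_sides = (\<lambda>(A, B, C). dist A B \<in> \<rat> \<and> dist B C \<in> \<rat> \<and> dist C A \<in> \<rat>)"

definition vertex_angle :: "real ^ 2 \<Rightarrow> real ^ 2 \<Rightarrow> real ^ 2 \<Rightarrow> real" where
  "vertex_angle A B C = arccos (((A - B) \<bullet> (C - B)) / (norm (A - B) * norm (C - B)))"
  \<comment> \<open>the angle at the middle argument, in radians; meaningful for \<open>A \<noteq> B\<close> and \<open>C \<noteq> B\<close>\<close>

definition has_angle :: "triangle \<Rightarrow> real \<Rightarrow> bool" where
  "has_angle = (\<lambda>(A, B, C) \<theta>.
     vertex_angle C A B = \<theta> \<or> vertex_angle A B C = \<theta> \<or> vertex_angle B C A = \<theta>)"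

definition isosceles :: "triangle \<Rightarrow> bool" where
  "isosceles = (\<lambda>(A, B, C). dist A B = dist B C \<or> dist B C = dist C A \<or> dist C A = dist A B)"
  \<comment> \<open>at least two equal sides, so equilateral triangles are included\<close>

definition perimeter :: "triangle \<Rightarrow> real" where
  "perimeter = (\<lambda>(A, B, C). dist A B + dist B C + dist C A)"

definition solid :: "triangle \<Rightarrow> (real ^ 2) set" where
  "solid = (\<lambda>(A, B, C). convex hull {A, B, C})"

definition area :: "triangle \<Rightarrow> real" where
  "area T = measure lebesgue (solid T)"

definition congruent_triangles :: "triangle \<Rightarrow> triangle \<Rightarrow> bool" where
  "congruent_triangles T T' \<longleftrightarrow>
     (\<exists>f :: real ^ 2 \<Rightarrow> real ^ 2. (\<forall>x y. dist (f x) (f y) = dist x y) \<and> f ` solid T = solid T')"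
  \<comment> \<open>a distance-preserving map of the plane need not preserve orientation: mirror images are
      congruent, and the order in which the vertices are listed plays no role\<close>

definition genuine_pair :: "real \<Rightarrow> triangle \<Rightarrow> triangle \<Rightarrow> bool" where
  "genuine_pair \<rho> T I \<longleftrightarrow>
     nondegenerate T \<and> rational_sides T \<and>
     nondegenerate I \<and> rational_sides I \<and>
     (\<exists>\<theta>. 0 < \<theta> \<and> \<theta> < pi \<and> cos \<theta> = \<rho> \<and> has_angle T \<theta>) \<and>
     isosceles I \<and>
     perimeter T = perimeter I \<and> area T = area I \<and>
     \<not> congruent_triangles T I"
  \<comment> \<open>the angle \<open>\<theta>\<close> is determined by \<open>\<rho>\<close>, and exists only for \<open>-1 < \<rho> < 1\<close>; the standing assumption
      that \<open>\<rho>\<close> is rational is left to the statements\<close>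

end

theory Submission
  imports Defs "HOL-Computational_Algebra.Nth_Powers" "HOL-Computational_Algebra.Squarefree"
begin

text \<open>Scale both triangles to semiperimeter 1. Let \<open>w = 1 - c\<close>, where \<open>c\<close> is the side opposite the angle of 60
  degrees, and let \<open>y\<close> be the base of the isosceles triangle. The tangent of 30 degrees is the inradius divided
  by \<open>w\<close>, so the first area is \<open>w / sqrt 3\<close>, and equality with the area of the isosceles triangle reads
  \<open>3 * (1 - y) = k^2\<close> for the rational number \<open>k = 2 * w / y\<close>, which is positive. Hence
  \<open>y\<close> and \<open>w\<close> are polynomials in \<open>k\<close>, and
  \<open>a\<close>, \<open>b\<close> are rational only if
  \<open>(k - 1)^2 * (k + 2) * (k + 3) * (k^2 - 3 * k + 6)\<close> is a rational square. For \<open>k = 1\<close> both triangles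
  are equilateral and therefore congruent. Otherwise \<open>k\<close> gives a rational point with positive first
  coordinate on the genus one curve \<open>z^2 = (k + 2) * (k + 3) * (k^2 - 3 * k + 6)\<close>
  (\<open>equal_perimeter_area_imp_equilateral\<close>).

  There is no such point (\<open>quartic_no_positive_rational_point\<close>). With \<open>x = 16 * (k + 3) / (k + 2)\<close> the curve becomes
  \<open>y^2 = x * (x^2 - 39 * x + 384)\<close>, whose group of rational points is cyclic of order 6: the values
  \<open>\<infinity>\<close>, 0, 16 and 24 of \<open>x\<close> come from \<open>k = -2\<close>, \<open>k = -3\<close>, \<open>k = \<infinity>\<close> and \<open>k = 0\<close>. That there are
  no others is a descent through the isogeny of degree 2 to
  \<open>y^2 = x * (x^2 + 78 * x - 15)\<close> and back, carried out on integers: up to translation by the point \<open>(0, 0)\<close>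
  every solution has \<open>x\<close> a square, and such a solution is twice another one, which is smaller unless it
  is the torsion point with \<open>x = 16\<close>. All the other homogeneous spaces are
  excluded by congruences modulo 3 and powers of 2.
  The descent lemmas are \<open>isogeny_descent\<close>, \<open>quartic_1_384_no_odd_solution\<close> and \<open>quartic_16_24_odd_solutions\<close>, and
  \<open>binary_quartic_square_values\<close> reduces the curve to them.\<close>

section \<open>Coprime factors and squares modulo small numbers\<close>

text \<open>The engine of every descent step: coprime factors of \<open>n * w ^ k\<close> are \<open>k\<close>-th powers up to
  complementary divisors of \<open>n\<close>, so for fixed \<open>n\<close> only finitely many new equations arise.\<close>

lemma coprime_factors_of_power_multiple:
  fixes U V n w :: int
  assumes "coprime U V" "U * V = n * w ^ k" "U > 0" "V > 0" "n > 0" "w > 0" "k > 0"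
  obtains n1 n2 u v where "U = n1 * u ^ k" "V = n2 * v ^ k" "n1 * n2 = n" "u * v = w"
    "n1 > 0" "n2 > 0" "u > 0" "v > 0" "coprime n1 n2" "coprime u v"
proof -
  have "n dvd U * V" using assms by simp
  then obtain d1 d2 where d: "n = d1 * d2" "d1 dvd U" "d2 dvd V"
    using division_decomp by blast
  define n1 n2 where "n1 = \<bar>d1\<bar>" and "n2 = \<bar>d2\<bar>"
  have n: "n = n1 * n2" "n1 dvd U" "n2 dvd V" "n1 > 0" "n2 > 0"
    using d \<open>n > 0\<close> by (auto simp: n1_def n2_def abs_mult[symmetric])
  obtain U1 V1 where UV: "U = n1 * U1" "V = n2 * V1" using n by (auto elim!: dvdE)
  have pos: "U1 > 0" "V1 > 0" using UV n assms by (auto simp: zero_less_mult_iff)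
  have prod: "U1 * V1 = w ^ k"
    using assms(2) n UV by (simp add: mult_ac)
  have cop: "coprime U1 V1" "coprime n1 n2" using assms(1) UV by auto
  have "coprime (nat U1) (nat V1)" using cop pos by (simp add: coprime_int_iff[symmetric])
  moreover have "nat U1 * nat V1 = nat w ^ k"
    using prod pos \<open>w > 0\<close> by (metis less_imp_le nat_mult_distrib nat_power_eq)
  ultimately have "is_nth_power k (nat U1)" "is_nth_power k (nat V1)"
    using is_nth_power_mult_coprime_natD[of "nat U1" "nat V1" k] pos by auto
  then obtain u v where "nat U1 = u ^ k" "nat V1 = v ^ k" by (auto elim!: is_nth_powerE)
  then have uv: "U1 = int u ^ k" "V1 = int v ^ k" using pos by (metis int_nat_eq less_imp_le of_nat_power)+
  then have uvpos: "u > 0" "v > 0" using pos \<open>k > 0\<close> by (auto intro!: Nat.gr0I simp: power_0_left)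
  have "(int u * int v) ^ k = w ^ k" using prod uv by (simp add: power_mult_distrib)
  then have "int u * int v = w" using power_eq_imp_eq_base[of "int u * int v" k w] assms by simp
  moreover have "coprime (int u) (int v)" using cop(1) uv \<open>k > 0\<close> by simp
  ultimately show ?thesis using that[of n1 "int u" n2 "int v"] UV uv n uvpos cop by simp
qed

lemma square_mod_16: "(c::int)^2 mod 16 \<in> {0, 1, 4, 9}"
proof -
  have "c mod 16 \<in> {0..<16}" by simp
  also have "{0..<16::int} = {0,1,2,3,4,5,6,7,8,9,10,11,12,13,14,15}" by (auto; presburger)
  finally show ?thesis by (subst power_mod[symmetric]) auto
qed

lemma odd_square_form: 
  assumes "odd (x::int)" obtains i where "x^2 = 8 * i + 1"
proof -
  obtain k where k: "x = 2 * k + 1" using assms by (elim oddE)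
  have "even (k * (k + 1))" by simp
  then obtain i where "k * (k + 1) = 2 * i" by (elim evenE)
  then have "x^2 = 8 * i + 1" unfolding k by (simp add: power2_eq_square algebra_simps)
  then show ?thesis using that by blast
qed

text \<open>Modulo 3 the form is \<open>2 * x^4\<close>, a square only if 3 divides \<open>x\<close>; then \<open>c^2\<close> and the first two
  terms are divisible by 9, which forces 3 to divide \<open>y\<close> as well. This rules out all but a few of the
  homogeneous spaces met below.\<close>

lemma no_square_value_mod_3:
  fixes e m f x y c :: int
  assumes "e mod 3 = 2" "\<not> 3 dvd f" "coprime x y"
  shows "e * x^4 + 3 * m * x^2 * y^2 + 3 * f * y^4 \<noteq> c^2"
proof
  assume eq: "e * x^4 + 3 * m * x^2 * y^2 + 3 * f * y^4 = c^2"
  have p3: "prime (3::int)" by simp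
  obtain e' where e': "e = 3 * e' + 2" using assms(1) by (metis mult_div_mod_eq)
  have sq: "t^2 mod 3 = (if 3 dvd t then 0 else 1)" for t :: int
  proof -
    have "t mod 3 \<in> {0..<3}" by simp
    also have "{0..<3::int} = {0,1,2}" by auto
    finally show ?thesis by (subst power_mod[symmetric]) (auto simp: dvd_eq_mod_eq_0)
  qed
  have c: "c^2 = 3 * (e' * x^4 + m * x^2 * y^2 + f * y^4) + 2 * (x^2)^2"
    using eq e' by (simp add: algebra_simps)
  have x: "3 dvd x"
  proof (rule ccontr)
    assume "\<not> 3 dvd x"
    then have "\<not> 3 dvd x^2" using p3 prime_dvd_power by blast
    then have "(x^2)^2 mod 3 = 1" using sq[of "x^2"] by simp
    then have "c^2 mod 3 = 2" unfolding c by presburger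
    then show False using sq[of c] by (auto split: if_splits)
  qed
  then obtain x' where x': "x = 3 * x'" by (auto elim!: dvdE)
  have "c^2 = 3 * (27 * e * x'^4 + 9 * m * x'^2 * y^2 + f * y^4)"
    using eq unfolding x' by (simp add: power_mult_distrib)
  then have "3 dvd c^2" by simp
  then have "3 dvd c" using p3 prime_dvd_power by blast
  then obtain c' where c': "c = 3 * c'" by (auto elim!: dvdE)
  have "f * y^4 = 3 * (c'^2 - 9 * e * x'^4 - 3 * m * x'^2 * y^2)"
    using eq unfolding x' c' by (simp add: power_mult_distrib algebra_simps)
  then have "3 dvd f * y^4" by simp
  then have "3 dvd y" using assms(2) p3 by (meson prime_dvd_mult_iff prime_dvd_power)
  then have "is_unit (3::int)" using x assms(3) coprime_common_divisor by blast
  then show False by simp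
qed

text \<open>In the descents the factors \<open>U\<close> and \<open>V\<close> turn out coprime because a common prime would have to
  divide \<open>w\<close>, and then both members of a coprime pair.\<close>

lemma common_prime_factor_dvd_base:
  fixes p n w :: int
  assumes "prime p" "p dvd U" "p dvd V" "U * V = n * w ^ k" "\<not> p ^ 2 dvd n"
  shows "p dvd w"
proof (rule ccontr)
  assume "\<not> p dvd w"
  then have "coprime (p ^ 2) (w ^ k)" using assms(1) by (simp add: prime_imp_coprime)
  moreover have "p ^ 2 dvd n * w ^ k"
    using assms(2-4) by (metis mult_dvd_mono power2_eq_square)
  ultimately show False using assms(5) by (simp add: coprime_dvd_mult_left_iff)
qed

text \<open>The case \<open>(n1, n2) = (5, 3)\<close> of \<open>isogeny_descent\<close>, where congruences modulo 3 do not suffice. For odd \<open>r\<close>, \<open>s\<close> the value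
  is 12 modulo 16; if one of them is even it is 3 modulo 4.\<close>

lemma no_square_value_mod_16:
  fixes r s h :: int
  assumes "coprime r s"
  shows "3 * s^4 - 5 * r^4 + 78 * r^2 * s^2 \<noteq> h^2"
proof
  assume eq: "3 * s^4 - 5 * r^4 + 78 * r^2 * s^2 = h^2"
  note sq = square_mod_16[of h]
  have p4: "x^4 = 64 * i^2 + 16 * i + 1" if "x^2 = 8*i+1" for x i :: int
  proof -
    have "x^4 = (x^2)^2" by simp
    then show ?thesis unfolding that by (simp add: power2_eq_square algebra_simps)
  qed
  consider "odd r" "odd s" | "odd r" "even s" | "even r" "odd s"
    using assms by (meson coprime_common_divisor odd_one)
  then show False
  proof cases
    case 1
    obtain i where i: "r^2 = 8*i+1" using odd_square_form[OF 1(1)] .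
    obtain j where j: "s^2 = 8*j+1" using odd_square_form[OF 1(2)] .
    obtain K where "h^2 = 16 * K + 12"
    proof
      show "h^2 = 16 * (4 + 42 * j + 34 * i + 312 * i * j + 12 * j^2 - 20 * i^2) + 12"
        using eq p4[OF i] p4[OF j] i j by algebra
    qed
    then have "h^2 mod 16 = 12" by presburger
    then show False using sq by simp
  next
    case 2
    then obtain i where i: "r^2 = 8*i+1" using odd_square_form by metis
    obtain t where "s = 2 * t" using 2 by (auto elim: evenE)
    obtain K where "h^2 = 4 * K + 3"
    proof
      show "h^2 = 4 * (12 * t^4 - 80 * i^2 - 20 * i - 2 + 78 * r^2 * t^2) + 3"
        using eq \<open>s = 2 * t\<close> unfolding p4[OF i] by (simp add: power_mult_distrib)
    qed
    then have "h^2 mod 4 = 3" by presburger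
    then show False using sq by (auto; presburger)
  next
    case 3
    then obtain j where j: "s^2 = 8*j+1" using odd_square_form by metis
    obtain t where "r = 2 * t" using 3 by (auto elim: evenE)
    obtain K where "h^2 = 4 * K + 3"
    proof
      show "h^2 = 4 * (48 * j^2 + 12 * j - 20 * t^4 + 78 * t^2 * s^2) + 3"
        using eq \<open>r = 2 * t\<close> unfolding p4[OF j] by (simp add: power_mult_distrib)
    qed
    then have "h^2 mod 4 = 3" by presburger
    then show False using sq by (auto; presburger)
  qed
qed

lemma square_mod_8: "(c::int)^2 mod 8 \<in> {0, 1, 4}"
proof -
  have "c mod 8 \<in> {0..<8}" by simp
  also have "{0..<8::int} = {0,1,2,3,4,5,6,7}" by (auto; presburger)
  finally show ?thesis by (subst power_mod[symmetric]) auto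
qed

text \<open>Since \<open>x^2\<close> and \<open>y^2\<close> are 1 modulo 8, the value is \<open>e - 39 + f\<close>, that is \<open>e + f + 1\<close>, modulo 8.\<close>

lemma odd_values_mod_8:
  fixes x y c e f :: int
  assumes "odd x" "odd y" "e * x^4 - 39 * x^2 * y^2 + f * y^4 = c^2"
  shows "(e + f + 1) mod 8 \<in> {0, 1, 4}"
proof -
  obtain i where i: "x^2 = 8 * i + 1" using odd_square_form[OF assms(1)] .
  obtain j where j: "y^2 = 8 * j + 1" using odd_square_form[OF assms(2)] .
  obtain K where K: "c^2 = 8 * K + (e + f + 1)"
  proof
    have "c^2 = e * (x^2)^2 - 39 * x^2 * y^2 + f * (y^2)^2" using assms(3) by simp
    also have "\<dots> = 8 * (e * (8 * i^2 + 2 * i) - 39 * (8 * i * j + i + j) +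
        f * (8 * j^2 + 2 * j) - 5) + (e + f + 1)"
      unfolding i j by algebra
    finally show "c^2 = \<dots>" .
  qed
  have "c^2 mod 8 \<in> {0, 1, 4}" by (rule square_mod_8)
  moreover have "c^2 mod 8 = (e + f + 1) mod 8" unfolding K by (rule mod_mult_self4)
  ultimately show ?thesis by simp
qed

lemma positive_factors:
  fixes U V :: int assumes "U * V > 0" "U + V \<ge> 0" shows "U > 0" "V > 0"
  using assms by (auto simp: zero_less_mult_iff)

lemma factor_pairs_15:
  fixes a b :: int assumes "a * b = 15" "a > 0" "b > 0"
  shows "(a, b) \<in> {(1,15),(3,5),(5,3),(15,1)}"
proof -
  have d: "a dvd 15" using assms(1) by (metis dvd_triv_left)
  then have "a \<le> 15" by (auto dest: zdvd_imp_le)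
  then have "a \<in> {1..15}" using assms by simp
  also have "{1..15::int} = {1,2,3,4,5,6,7,8,9,10,11,12,13,14,15}" by (auto; presburger)
  finally have "a \<in> {1,3,5,15}" using d by (auto simp: dvd_eq_mod_eq_0)
  then show ?thesis using assms(1) by auto
qed

lemma factor_pairs_6:
  fixes a b :: int assumes "a * b = 6" "a > 0" "b > 0"
  shows "(a, b) \<in> {(1,6),(2,3),(3,2),(6,1)}"
proof -
  have d: "a dvd 6" using assms(1) by (metis dvd_triv_left)
  then have "a \<le> 6" by (auto dest: zdvd_imp_le)
  then have "a \<in> {1..6}" using assms by simp
  also have "{1..6::int} = {1,2,3,4,5,6}" by (auto; presburger)
  finally have "a \<in> {1,2,3,6}" using d by (auto simp: dvd_eq_mod_eq_0)
  then show ?thesis using assms(1) by auto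
qed

lemma coprime_power_2_if_odd: "odd (x::int) \<Longrightarrow> coprime x (2 ^ n)"
  by simp

lemma coprime_factor_pairs_384:
  fixes a b :: int assumes "a * b = 384" "a > 0" "b > 0" "coprime a b"
  shows "(a, b) \<in> {(1,384),(3,128),(128,3),(384,1)}"
proof -
  have *: "(a, b) \<in> {(1,384),(3,128)}" if "a * b = 384" "a > 0" "b > 0" "odd a" for a b :: int
  proof -
    have "coprime a (2 ^ 7)" using that(4) coprime_power_2_if_odd by blast
    moreover have "a dvd 384" using that(1) by (metis dvd_triv_left)
    then have "a dvd 2 ^ 7 * 3" by simp
    ultimately have "a dvd 3" by (metis coprime_dvd_mult_right_iff)
    then have "a \<le> 3" by (auto dest: zdvd_imp_le)
    then have "a = 1 \<or> a = 2 \<or> a = 3" using that by presburger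
    then show ?thesis using that by auto
  qed
  have "odd a \<or> odd b" using assms(4) by (meson coprime_common_divisor odd_one)
  then show ?thesis using *[of a b] *[of b a] assms by (auto simp: mult.commute)
qed

lemma prime_square_not_dvd:
  fixes p :: int assumes "prime p" shows "\<not> p^2 dvd 15" "\<not> p^2 dvd 6"  "odd p \<Longrightarrow> \<not> p^2 dvd 384"
proof -
  have p: "p \<ge> 2" using assms by (simp add: prime_ge_2_int)
  have small: "p \<le> m" if "p^2 < (m+1)^2" "m \<ge> 0" for m
    using that p by (smt (verit) power2_less_imp_less)
  show "\<not> p^2 dvd 15"
  proof
    assume d: "p^2 dvd 15" 
    then have "p \<le> 3" using small[of 3] by (auto dest!: zdvd_imp_le)
    then have "p = 2 \<or> p = 3" using p by presburger
    then show False using d by auto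
  qed
  show "\<not> p^2 dvd 6"
  proof
    assume d: "p^2 dvd 6" 
    then have "p \<le> 2" using small[of 2] by (auto dest!: zdvd_imp_le)
    then have "p = 2" using p by presburger
    then show False using d by auto
  qed
  show "\<not> p^2 dvd 384" if "odd p"
  proof
    assume d: "p^2 dvd 384" 
    have "coprime (p^2) (2^7)"
      by (rule coprime_power_2_if_odd) (use that in simp)
    moreover have "p^2 dvd 2^7 * 3" using d by simp
    ultimately have "p^2 dvd 3" by (metis coprime_dvd_mult_right_iff)
    then have "p \<le> 1" using small[of 1] by (auto dest!: zdvd_imp_le)
    then show False using p by simp
  qed
qed

section \<open>Descent on the elliptic curve\<close>

text \<open>The first half of a division by 2. A solution is a point with first coordinate \<open>h^2 / w^2\<close> on
  \<open>y^2 = x * (x^2 - 156 * x + 6144)\<close>, a rescaling of \<open>y^2 = x * (x^2 - 39 * x + 384)\<close>; the conclusion is a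
  point on the isogenous curve \<open>y^2 = x * (x^2 + 78 * x - 15)\<close> above it. Completing the square gives
  \<open>(e - (h^2 - 78 * w^2)) * (e + (h^2 - 78 * w^2)) = 60 * w^4\<close>. Half of each factor is
  \<open>U\<close> and \<open>V\<close>, with product \<open>15 * w^4\<close>; of the four ways to distribute the divisors of 15 three are
  impossible modulo 3 or 16.\<close>

lemma isogeny_descent:
  fixes h w e :: int
  assumes cop: "coprime h w" and w: "w > 0"
    and eq: "h^4 - 156 * h^2 * w^2 + 6144 * w^4 = e^2"
  obtains r s where "r > 0" "s > 0" "coprime r s" "r * s = w"
    "h^2 = r^4 + 78 * r^2 * s^2 - 15 * s^4"
proof -
  define d where "d = h^2 - 78 * w^2"
  have "even (e^2) \<longleftrightarrow> even (h^4)" unfolding eq[symmetric] by simp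
  then have "even (\<bar>e\<bar> - d)" by (simp add: d_def)
  then obtain U where U: "\<bar>e\<bar> = d + 2 * U" by (metis add.commute diff_add_cancel evenE)
  define V where "V = U + d"
  have "4 * (U * V) = \<bar>e\<bar>^2 - d^2" unfolding U V_def by (simp add: power2_eq_square algebra_simps)
  also have "\<dots> = 60 * w^4"
    unfolding power2_abs eq[symmetric] d_def
    by (simp add: power2_eq_square power4_eq_xxxx algebra_simps)
  finally have UV: "U * V = 15 * w^4" by simp
  have "U * V > 0" "U + V \<ge> 0" using UV w U V_def by auto
  note pos = positive_factors[OF this]
  have copUV: "coprime U V"
  proof (rule ccontr)
    assume "\<not> coprime U V"
    then obtain p where p: "prime p" "p dvd U" "p dvd V"
      using prime_factor_int[of "gcd U V"] by (auto simp: coprime_iff_gcd_eq_1)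
    then have pw: "p dvd w" using common_prime_factor_dvd_base UV prime_square_not_dvd by metis
    have "h^2 = V - U + 78 * w * w" by (simp add: V_def d_def power2_eq_square)
    then have "p dvd h^2" using p pw by simp
    then have "p dvd h" using p(1) prime_dvd_power by blast
    then show False using cop p(1) pw by (meson coprime_common_divisor not_prime_unit)
  qed
  obtain n1 n2 s r where f: "U = n1 * s^4" "V = n2 * r^4" "n1 * n2 = 15" "s * r = w"
    "n1 > 0" "n2 > 0" "s > 0" "r > 0" "coprime s r"
    using coprime_factors_of_power_multiple[OF copUV UV pos] w by (metis zero_less_numeral)
  have h: "h^2 = n2 * r^4 - n1 * s^4 + 78 * r^2 * s^2"
  proof -
    have "h^2 = V - U + 78 * w^2" by (simp add: V_def d_def)
    then show ?thesis by (simp add: f(1,2) f(4)[symmetric] power_mult_distrib)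
  qed
  have cop': "coprime r s" using f(9) by (simp add: coprime_commute)
  consider "n1 = 1" "n2 = 15" | "n1 = 3" "n2 = 5" | "n1 = 5" "n2 = 3" | "n1 = 15" "n2 = 1"
    using factor_pairs_15[OF f(3,5,6)] by auto
  then show ?thesis
  proof cases
    case 1
    then show ?thesis using no_square_value_mod_3[of "-1" 5 s r 26 h] h f(9) by (simp add: algebra_simps)
  next
    case 2
    then show ?thesis using no_square_value_mod_3[of 5 "-1" r s 26 h] h cop' by (simp add: algebra_simps)
  next
    case 3
    then show ?thesis using no_square_value_mod_16[OF f(9), of h] h by (simp add: algebra_simps)
  next
    case 4
    then show ?thesis using that[of r s] h f cop' by (simp add: algebra_simps)
  qed
qed

text \<open>Infinite descent on \<open>b\<close>. After \<open>isogeny_descent\<close> with \<open>w = b / 2\<close>, the equation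
  \<open>(r^2 + 39 * s^2)^2 - a^2 = 1536 * s^4\<close> is factored again, and coprimality and congruences modulo 3
  leave only the original equation with \<open>u * v = s\<close>, where \<open>s\<close> is at most \<open>b / 2\<close>.\<close>

lemma quartic_1_384_no_odd_solution:
  fixes a b c :: int
  assumes "coprime a b" "odd a" "b > 0"
  shows "a^4 - 39 * a^2 * b^2 + 384 * b^4 \<noteq> c^2"
  using assms
proof (induction "nat b" arbitrary: a b c rule: less_induct)
  case less
  show ?case
  proof
    assume eq: "a^4 - 39 * a^2 * b^2 + 384 * b^4 = c^2"
    have "even b"
    proof (rule ccontr)
      assume "odd b"
      then show False using odd_values_mod_8[OF less.prems(2) _, of b 1 384 c] eq by simp
    qed
    then obtain \<beta> where \<beta>: "b = 2 * \<beta>" by (elim evenE)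
    have "coprime a \<beta>" "\<beta> > 0" "a^4 - 156 * a^2 * \<beta>^2 + 6144 * \<beta>^4 = c^2"
      using less.prems eq unfolding \<beta> by (auto simp: power_mult_distrib)
    then obtain r s where rs: "r > 0" "s > 0" "coprime r s" "r * s = \<beta>"
      and a2: "a^2 = r^4 + 78 * r^2 * s^2 - 15 * s^4" by (rule isogeny_descent)
    have "odd (a^2)" using less.prems by simp
    (* For odd r and s the right-hand side of a2 would be even. *)
    then have "odd r \<noteq> odd s" unfolding a2 by (auto simp: even_add)
    then have "even (r^2 + 39 * s^2 - a)" using less.prems by auto
    then obtain U where U: "r^2 + 39 * s^2 - a = 2 * U" by (elim evenE)
    define V where "V = U + a"
    have sum: "U + V = r^2 + 39 * s^2" using U V_def by simp
    have "4 * (U * V) = (r^2 + 39 * s^2)^2 - a^2"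
      unfolding sum[symmetric] V_def by (simp add: power2_eq_square algebra_simps)
    also have "\<dots> = 1536 * s^4" unfolding a2 by algebra
    finally have UV: "U * V = 384 * s^4" by simp
    have "U * V > 0" "U + V \<ge> 0" using UV sum rs by auto
    note pos = positive_factors[OF this]
    have copUV: "coprime U V"
    proof (rule ccontr)
      assume "\<not> coprime U V"
      then obtain p where p: "prime p" "p dvd U" "p dvd V"
        using prime_factor_int[of "gcd U V"] by (auto simp: coprime_iff_gcd_eq_1)
      have "p dvd V - U" using p by (intro dvd_diff)
      then have "odd p" using less.prems V_def by auto
      then have ps: "p dvd s" using common_prime_factor_dvd_base[OF p UV] prime_square_not_dvd(3)[OF p(1)] by blast
      have "r^2 = U + V - 39 * s * s" using sum by (simp add: power2_eq_square)
      then have "p dvd r^2" using p ps by simp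
      then have "p dvd r" using p(1) prime_dvd_power by blast
      then show False using rs(3) p(1) ps by (meson coprime_common_divisor not_prime_unit)
    qed
    obtain n1 n2 u v where f: "U = n1 * u^4" "V = n2 * v^4" "n1 * n2 = 384" "u * v = s"
      "n1 > 0" "n2 > 0" "u > 0" "v > 0" "coprime n1 n2" "coprime u v"
      using coprime_factors_of_power_multiple[OF copUV UV pos] rs by (metis zero_less_numeral)
    have r2: "r^2 = n1 * u^4 - 39 * u^2 * v^2 + n2 * v^4"
      using sum by (simp add: f(1,2) f(4)[symmetric] power_mult_distrib)
    have "1 * (u * v) \<le> r * (u * v)"
      using rs(1) f(7,8) by (intro mult_right_mono) auto
    moreover have "u * 1 \<le> u * v" "1 * v \<le> u * v"
      using f(7,8) by (intro mult_left_mono mult_right_mono; simp)+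
    ultimately have uv: "u < b" "v < b" using rs(4) f(4) \<beta> \<open>\<beta> > 0\<close> by auto
    have odd: "odd (U + V)" using \<open>odd r \<noteq> odd s\<close> unfolding sum by auto
    have cop': "coprime v u" using f(10) by (simp add: coprime_commute)
    consider "n1 = 1" "n2 = 384" | "n1 = 3" "n2 = 128" | "n1 = 128" "n2 = 3" | "n1 = 384" "n2 = 1"
      using coprime_factor_pairs_384[OF f(3,5,6,9)] by auto
    then show False
    proof cases
      case 1
      have "odd u" using odd 1 f(1,2) by auto
      then show False using less.hyps[where a = u and b = v and c = r] uv f r2 1 by simp
    next
      case 2
      then show False using no_square_value_mod_3[of 128 1 v u "-13" r] r2 cop' by (simp add: algebra_simps)
    next
      case 3
      then show False using no_square_value_mod_3[of 128 1 u v "-13" r] r2 f(10) by (simp add: algebra_simps)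
    next
      case 4
      have "odd v" using odd 4 f(1,2) by auto
      then show False using less.hyps[where a = v and b = u and c = r] uv f cop' r2 4 by (simp add: algebra_simps)
    qed
  qed
qed

text \<open>The same two factorisations as in \<open>quartic_1_384_no_odd_solution\<close>, applied to \<open>h = 8 * a\<close> and \<open>w = b\<close>.
  As \<open>b\<close> is odd, no factor 2 is gained, and the descent need not be strict: the solution
  \<open>(1, 1)\<close>, which comes from a 3-torsion point, reproduces itself. If the second
  coordinate fails to decrease, then \<open>r\<close> and the first new coordinate are 1, and the equation
  becomes \<open>3 * (y^2 - 1) * (8 * y^2 - 5) = 0\<close>.\<close>

lemma quartic_16_24_odd_solutions:
  fixes a b c :: int
  assumes "coprime a b" "odd a" "odd b" "a > 0" "b > 0"
    "16 * a^4 - 39 * a^2 * b^2 + 24 * b^4 = c^2"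
  shows "a = 1 \<and> b = 1"
  using assms
proof (induction "nat b" arbitrary: a b c rule: less_induct)
  case less
  note eq = less.prems(6)
  have "coprime (2 ^ 3) b" using less.prems(3) coprime_power_2_if_odd[of b 3] by (simp add: coprime_commute)
  then have "coprime (8 * a) b" using less.prems(1) by simp
  moreover have "(8 * a)^4 - 156 * (8 * a)^2 * b^2 + 6144 * b^4 = (16 * c)^2"
    using eq by (simp add: power_mult_distrib)
  ultimately obtain r s where rs: "r > 0" "s > 0" "coprime r s" "r * s = b"
    and a2: "(8 * a)^2 = r^4 + 78 * r^2 * s^2 - 15 * s^4"
    using isogeny_descent less.prems(5) by metis
  have "odd r" "odd s" using less.prems(3) rs(4) by auto
  obtain i where i: "r^2 = 8 * i + 1" using odd_square_form[OF \<open>odd r\<close>] .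
  obtain j where j: "s^2 = 8 * j + 1" using odd_square_form[OF \<open>odd s\<close>] .
  define m where "m = i + 39 * j + 5"
  have m: "8 * m = r^2 + 39 * s^2" unfolding m_def i j by simp
  have "64 * (m^2 - a^2) = (r^2 + 39 * s^2)^2 - (8 * a)^2"
    unfolding m[symmetric] by (simp add: power_mult_distrib)
  also have "\<dots> = 1536 * s^4" unfolding a2 by algebra
  finally have ma: "m^2 - a^2 = 24 * s^4" by simp
  then have "even (m^2 - a^2)" by simp
  then have "even (m - a)" by simp
  then obtain U where U: "m - a = 2 * U" by (elim evenE)
  define V where "V = U + a"
  have sum: "8 * (U + V) = r^2 + 39 * s^2" unfolding m[symmetric] using U V_def by simp
  have "4 * (U * V) = m^2 - a^2"
    using U V_def by algebra
  then have UV: "U * V = 6 * s^4" using ma by simp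
  have "U * V > 0" using UV rs by auto
  moreover have "U + V \<ge> 0" using sum rs by (smt (verit) zero_le_power2)
  ultimately have pos: "U > 0" "V > 0" using positive_factors by blast+
  have copUV: "coprime U V"
  proof (rule ccontr)
    assume "\<not> coprime U V"
    then obtain p where p: "prime p" "p dvd U" "p dvd V"
      using prime_factor_int[of "gcd U V"] by (auto simp: coprime_iff_gcd_eq_1)
    then have ps: "p dvd s" using common_prime_factor_dvd_base[OF p UV] prime_square_not_dvd(2)[OF p(1)] by blast
    have "r^2 = 8 * (U + V) - 39 * s * s" using sum by (simp add: power2_eq_square)
    then have "p dvd r^2" using p ps by simp
    then have "p dvd r" using p(1) prime_dvd_power by blast
    then show False using rs(3) p(1) ps by (meson coprime_common_divisor not_prime_unit)
  qed
  obtain n1 n2 u v where f: "U = n1 * u^4" "V = n2 * v^4" "n1 * n2 = 6" "u * v = s"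
    "n1 > 0" "n2 > 0" "u > 0" "v > 0" "coprime u v"
    using coprime_factors_of_power_multiple[OF copUV UV pos] rs by (metis zero_less_numeral)
  have r2: "r^2 = 8 * n1 * u^4 - 39 * u^2 * v^2 + 8 * n2 * v^4"
    using sum by (simp add: f(1,2) f(4)[symmetric] power_mult_distrib)
  have cop': "coprime v u" using f(9) by (simp add: coprime_commute)
  have odduv: "odd u" "odd v" using f(4) \<open>odd s\<close> by auto
  have step: "a = 1 \<and> b = 1" if "x * y = s" "coprime x y" "x > 0" "y > 0" "odd x" "odd y"
    "16 * x^4 - 39 * x^2 * y^2 + 24 * y^4 = r^2" for x y
  proof -
    have b: "b = r * x * y" using that(1) rs(4) by (simp add: mult.assoc)
    have xy: "x = 1 \<and> y = 1"
    proof (cases "y < b")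
      case True
      then show ?thesis using less.hyps[where a = x and b = y and c = r] that by simp
    next
      case False
      have "y * 1 \<le> y * (r * x)" using rs(1) that by (intro mult_left_mono) (auto simp: int_one_le_iff_zero_less)
      with False b have "y * (r * x) = y * 1" by (simp add: mult_ac)
      then have "r * x = 1" using that by simp
      then have "r = 1" "x = 1" using rs(1) that zmult_eq_1_iff[of r x] by auto
      then have "(y^2 - 1) * (8 * y^2 - 5) = 0" using that(7) by algebra
      then have "y^2 = 1" by (auto; presburger)
      then show ?thesis using \<open>x = 1\<close> \<open>y > 0\<close> by (simp add: power2_eq_1_iff)
    qed
    then have "r^2 = 1" using that(7) by simp
    then have "r = 1" using rs(1) by (simp add: power2_eq_1_iff)
    have "s = 1" using that(1) xy by simp
    have "a^2 = 1" using a2 \<open>r = 1\<close> \<open>s = 1\<close> by (simp add: power_mult_distrib)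
    then have "a = 1" using less.prems(4) by (simp add: power2_eq_1_iff)
    then show ?thesis using b xy \<open>r = 1\<close> by simp
  qed
  consider "n1 = 1" "n2 = 6" | "n1 = 2" "n2 = 3" | "n1 = 3" "n2 = 2" | "n1 = 6" "n2 = 1"
    using factor_pairs_6[OF f(3,5,6)] by auto
  then show ?case
  proof cases
    case 1
    then show ?thesis using no_square_value_mod_3[of 8 16 u v "-13" r] r2 f(9) by simp
  next
    case 2
    then show ?thesis using step[of u v] r2 f odduv by simp
  next
    case 3
    then show ?thesis using step[of v u] r2 f odduv cop' by (simp add: algebra_simps)
  next
    case 4
    then show ?thesis using no_square_value_mod_3[of 8 16 v u "-13" r] r2 cop' by (simp add: algebra_simps)
  qed
qed

text \<open>Two exact divisions by 4, separated by congruences modulo 8, turn a solution with \<open>b\<close> even into one of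
  the equation excluded by \<open>quartic_1_384_no_odd_solution\<close>; they contradict parity when \<open>a\<close> is even.\<close>

lemma quartic_16_24_solutions:
  fixes a b c :: int
  assumes "coprime a b" "a > 0" "b > 0" and eq: "16 * a^4 - 39 * a^2 * b^2 + 24 * b^4 = c^2"
  shows "a = 1 \<and> b = 1"
proof -
  consider "odd a" "odd b" | "odd a" "even b" | "even a" "odd b"
    using assms(1) by (meson coprime_common_divisor odd_one)
  then show ?thesis
  proof cases
    case 1
    then show ?thesis using quartic_16_24_odd_solutions[OF assms(1) 1 assms(2,3) eq] by simp
  next
    case 2
    then obtain b1 where b1: "b = 2 * b1" by (auto elim: evenE)
    have "even (c^2)" unfolding eq[symmetric] b1 by simp
    then obtain c1 where c1: "c = 2 * c1" by (auto elim: evenE)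
    have eq1: "4 * a^4 - 39 * a^2 * b1^2 + 96 * b1^4 = c1^2"
      using eq unfolding b1 c1 by (simp add: power_mult_distrib)
    have "even b1" using odd_values_mod_8[OF 2(1) _ eq1] by auto
    then obtain b2 where b2: "b1 = 2 * b2" by (elim evenE)
    have "even (c1^2)" unfolding eq1[symmetric] b2 by simp
    then obtain c2 where c2: "c1 = 2 * c2" by (auto elim: evenE)
    have eq2: "a^4 - 39 * a^2 * b2^2 + 384 * b2^4 = c2^2"
      using eq1 unfolding b2 c2 by (simp add: power_mult_distrib)
    have "coprime a b2" "b2 > 0" using assms b1 b2 by auto
    then show ?thesis using quartic_1_384_no_odd_solution[of a b2 c2] 2 eq2 by blast
  next
    case 3
    then obtain a1 where a1: "a = 2 * a1" by (auto elim: evenE)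
    have "even (c^2)" unfolding eq[symmetric] a1 by simp
    then obtain c1 where c1: "c = 2 * c1" by (auto elim: evenE)
    have eq1: "64 * a1^4 - 39 * a1^2 * b^2 + 6 * b^4 = c1^2"
      using eq unfolding a1 c1 by (simp add: power_mult_distrib)
    have "even a1" using odd_values_mod_8[OF _ 3(2) eq1] by auto
    then obtain a2 where a2: "a1 = 2 * a2" by (elim evenE)
    have "even (c1^2)" unfolding eq1[symmetric] a2 by simp
    then obtain c2 where c2: "c1 = 2 * c2" by (auto elim: evenE)
    have "3 * b^4 = 2 * (c2^2 - 256 * a2^4 + 39 * a2^2 * b^2)"
      using eq1 unfolding a2 c2 by (simp add: power_mult_distrib)
    then have "even (3 * b^4)" by (metis dvd_triv_left)
    then show ?thesis using 3 by simp
  qed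
qed

lemma quartic_96_4_no_solution:
  fixes a b c :: int
  assumes "coprime a b" "a > 0" "odd b"
  shows "96 * a^4 - 39 * a^2 * b^2 + 4 * b^4 \<noteq> c^2"
proof
  assume eq: "96 * a^4 - 39 * a^2 * b^2 + 4 * b^4 = c^2"
  have "even a" using odd_values_mod_8[OF _ assms(3) eq] by auto
  then obtain a1 where a1: "a = 2 * a1" by (elim evenE)
  have "even (c^2)" unfolding eq[symmetric] a1 by simp
  then obtain c1 where c1: "c = 2 * c1" by (auto elim: evenE)
  have "384 * a1^4 - 39 * a1^2 * b^2 + b^4 = c1^2"
    using eq unfolding a1 c1 by (simp add: power_mult_distrib)
  then have "b^4 - 39 * b^2 * a1^2 + 384 * a1^4 = c1^2" by (simp add: algebra_simps)
  moreover have "coprime b a1" "a1 > 0" using assms a1 by (auto simp: coprime_commute)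
  ultimately show False using quartic_1_384_no_odd_solution[of b a1 c1] assms(3) by blast
qed

section \<open>The binary quartic form\<close>

text \<open>Cancelling \<open>g = gcd n t\<close> from \<open>n dvd t^2\<close> leaves \<open>n div g\<close> dividing \<open>g\<close>, so that \<open>(n div g)^2\<close> divides the
  squarefree number \<open>n\<close>.\<close>

lemma squarefree_dvd_squareD:
  fixes n t :: int
  assumes "squarefree n" "n dvd t^2"
  shows "n dvd t"
proof -
  have "n \<noteq> 0" using assms(1) by auto
  define g where "g = gcd n t"
  have "g \<noteq> 0" using \<open>n \<noteq> 0\<close> by (simp add: g_def)
  obtain n' t' where nt: "n = g * n'" "t = g * t'" "coprime n' t'"
    using gcd_coprime_exists[of n t] \<open>g \<noteq> 0\<close> unfolding g_def by (metis mult.commute)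
  have "g * n' dvd g * (g * t'^2)" using assms(2) nt by (simp add: power2_eq_square mult_ac)
  then have "n' dvd g * t'^2" using \<open>g \<noteq> 0\<close> by simp
  then have "n' dvd g" using nt(3) by (simp add: coprime_dvd_mult_left_iff)
  then have "n'^2 dvd n" using nt(1) by (simp add: power2_eq_square mult_dvd_mono)
  then have "is_unit n'" using assms(1) squarefreeD by blast
  then have "n dvd g" using nt(1) by (simp add: dvd_mult_unit_iff')
  then show ?thesis using nt(2) by (meson dvd_mult2)
qed

lemma squarefree_decomposition:
  fixes M :: int assumes "M > 0"
  obtains m b where "M = m * b^2" "squarefree m" "m > 0" "b > 0"
proof
  show "M = squarefree_part M * \<bar>square_part M\<bar>^2" using squarefree_decompose[of M] by simp
  show "squarefree (squarefree_part M)" by simp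
  show "\<bar>square_part M\<bar> > 0" using assms by simp
  then show "squarefree_part M > 0"
    using assms squarefree_decompose[of M] by (metis zero_less_mult_iff zero_le_power2 not_less)
qed

lemma squarefree_divisors_24:
  fixes n :: int assumes "squarefree n" "n > 0" "n dvd 24" shows "n \<in> {1, 2, 3, 6}"
proof -
  have "n \<le> 24" using assms(3) by (auto dest: zdvd_imp_le)
  then have "n \<in> {1..24}" using assms by simp
  also have "{1..24::int} = {1,2,3,4,5,6,7,8,9,10,11,12,13,14,15,16,17,18,19,20,21,22,23,24}"
    by (auto; presburger)
  finally have "n \<in> {1,2,3,4,6,8,12,24}" using assms(3) by auto
  moreover have "\<not> 4 dvd n" using squarefreeD[OF assms(1), of 2] by auto
  ultimately show ?thesis by auto
qed

lemma squarefree_divisors_16: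
  fixes n :: int assumes "squarefree n" "n > 0" "n dvd 16" shows "n \<in> {1, 2}"
proof -
  have "n \<le> 16" using assms(3) by (auto dest: zdvd_imp_le)
  then have "n \<in> {1..16}" using assms by simp
  also have "{1..16::int} = {1,2,3,4,5,6,7,8,9,10,11,12,13,14,15,16}"
    by (auto; presburger)
  finally have "n \<in> {1,2,4,8,16}" using assms(3) by auto
  moreover have "\<not> 4 dvd n" using squarefreeD[OF assms(1), of 2] by auto
  ultimately show ?thesis by auto
qed

text \<open>These are the finite rational points with \<open>y \<noteq> 0\<close> on \<open>y^2 = x * (x^2 - 39 * x + 384)\<close>, where \<open>x = 16 * N / M\<close>. The squarefree
  parts \<open>m\<close> of \<open>M\<close> and \<open>n\<close> of \<open>N\<close> must divide the quadratic factor, hence 16 and 24 respectively. This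
  leaves six coprime pairs \<open>(m, n)\<close>, of which modulo 3 excludes three and the quartics treated above settle
  the others.\<close>

lemma binary_quartic_square_values:
  fixes M N t :: int
  assumes cop: "coprime M N" and pos: "M > 0" "N > 0"
    and eq: "M * N * (16 * N^2 - 39 * M * N + 24 * M^2) = t^2"
  shows "M = 1 \<and> N = 1 \<or> M = 2 \<and> N = 3"
proof -
  define Q where "Q = 16 * N^2 - 39 * M * N + 24 * M^2"
  obtain m b where m: "M = m * b^2" "squarefree m" "m > 0" "b > 0" using squarefree_decomposition[OF pos(1)] .
  obtain n a where n: "N = n * a^2" "squarefree n" "n > 0" "a > 0" using squarefree_decomposition[OF pos(2)] .
  have cop': "coprime m n" "coprime b a" "coprime m a" "coprime b n" using cop m n by auto
  have t: "(a * b)^2 * (m * n * Q) = t^2" using eq m n unfolding Q_def by algebra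
  then have "(a * b)^2 dvd t^2" by (metis dvd_triv_left)
  then have "a * b dvd t" by simp
  then obtain t1 where "t = a * b * t1" by (elim dvdE)
  then have t1: "m * n * Q = t1^2" using t m n by (simp add: power_mult_distrib)
  then have "m * n dvd t1^2" by (metis dvd_triv_left)
  moreover have "squarefree (m * n)" using squarefree_mult_coprime[OF cop'(1)] m n by blast
  ultimately have "m * n dvd t1" using squarefree_dvd_squareD by blast
  then obtain c where "t1 = m * n * c" by (elim dvdE)
  then have Qc: "Q = m * n * c^2" using t1 m n by (simp add: power2_eq_square)
  have m2: "m \<in> {1, 2}"
  proof (rule squarefree_divisors_16[OF m(2,3)])
    have "16 * N^2 = m * (n * c^2 + 39 * b^2 * N - 24 * b^2 * M)"
      using Qc unfolding Q_def m(1) by algebra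
    then have "m dvd 16 * N^2" by (metis dvd_triv_left)
    moreover have "coprime m (N^2)" using cop m by auto
    ultimately show "m dvd 16" by (simp add: coprime_dvd_mult_left_iff)
  qed
  have n2: "n \<in> {1, 2, 3, 6}"
  proof (rule squarefree_divisors_24[OF n(2,3)])
    have "24 * M^2 = n * (m * c^2 + 39 * a^2 * M - 16 * a^2 * N)"
      using Qc unfolding Q_def n(1) by algebra
    then have "n dvd 24 * M^2" by (metis dvd_triv_left)
    moreover have "coprime n (M^2)" using cop n by (auto simp: coprime_commute)
    ultimately show "n dvd 24" by (simp add: coprime_dvd_mult_left_iff)
  qed
  have E: "16 * n^2 * a^4 - 39 * m * n * a^2 * b^2 + 24 * m^2 * b^4 = m * n * c^2"
    using Qc unfolding Q_def m(1) n(1) by algebra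
  have ab: "coprime a b" using cop'(2) by (simp add: coprime_commute)
  consider "m = 1" "n = 1" | "m = 1" "n = 2" | "m = 1" "n = 3" | "m = 1" "n = 6"
    | "m = 2" "n = 1" | "m = 2" "n = 3" | "m = 2" "even n"
    using m2 n2 by auto
  then show ?thesis
  proof cases
    case 1
    then show ?thesis using quartic_16_24_solutions[of a b c] E m n ab by simp
  next
    case 2
    then show ?thesis using no_square_value_mod_3[of 32 4 a b "-13" c] E ab by simp
  next
    case 3
    then show ?thesis using no_square_value_mod_3[of 8 16 b a "-13" c] E cop' by (simp add: algebra_simps)
  next
    case 4
    have "odd b" using cop'(4) 4 by (metis coprime_common_divisor even_numeral odd_one)
    then show ?thesis using quartic_96_4_no_solution[of a b c] E ab n 4 by simp
  next
    case 5
    then show ?thesis using no_square_value_mod_3[of 8 16 a b "-13" c] E ab by simp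
  next
    case 6
    then have "16 * b^4 - 39 * b^2 * a^2 + 24 * a^4 = c^2" using E by (simp add: algebra_simps)
    then show ?thesis using quartic_16_24_solutions[of b a c] m n cop' 6 by simp
  next
    case 7
    then show ?thesis using cop'(1) by (metis coprime_common_divisor dvd_refl odd_one)
  qed
qed

text \<open>For \<open>k = p / q\<close> put \<open>M = p + 2 * q\<close> and \<open>N = p + 3 * q\<close>; then \<open>q = N - M\<close>, \<open>p = 3 * M - 2 * N\<close>, and
  \<open>q^4\<close> times the left-hand side is the binary form of \<open>binary_quartic_square_values\<close>. Its
  solutions \<open>(1, 1)\<close> and \<open>(2, 3)\<close> have \<open>q = 0\<close> and \<open>p = 0\<close>: they are the point at infinity and \<open>k = 0\<close>.\<close>

lemma quartic_no_positive_rational_point: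
  fixes k z :: real
  assumes "k \<in> \<rat>" "z \<in> \<rat>" "k > 0"
  shows "(k + 2) * (k + 3) * (k^2 - 3 * k + 6) \<noteq> z^2"
proof
  assume eq: "(k + 2) * (k + 3) * (k^2 - 3 * k + 6) = z^2"
  obtain p q :: nat where pq: "q \<noteq> 0" "\<bar>k\<bar> = real p / real q" "coprime p q"
    using Rats_abs_nat_div_natE[OF assms(1)] .
  then have k: "k = real p / real q" "p > 0" using assms(3) by (auto intro: Nat.gr0I)
  obtain u v :: nat where uv: "v \<noteq> 0" "\<bar>z\<bar> = real u / real v" "coprime u v"
    using Rats_abs_nat_div_natE[OF assms(2)] .
  define M N where "M = int p + 2 * int q" and "N = int p + 3 * int q"
  define X where "X = M * N * (16 * N^2 - 39 * M * N + 24 * M^2)"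
  have "z^2 = (real u / real v)^2" using uv(2) by (metis power2_abs)
  then have "real v^2 * (real q^4 * ((k + 2) * (k + 3) * (k^2 - 3 * k + 6))) = real q^4 * real u^2"
    unfolding eq using uv(1) by (simp add: power_divide)
  moreover have "real q^4 * ((k + 2) * (k + 3) * (k^2 - 3 * k + 6)) = real_of_int X"
  proof -
    have p: "real p = k * real q" using k pq by simp
    show ?thesis unfolding X_def M_def N_def by (simp add: p) algebra
  qed
  ultimately have "real_of_int (int v^2 * X) = real_of_int (int q^4 * int u^2)" by simp
  then have X: "int v^2 * X = (int q^2 * int u)^2"
    unfolding of_int_eq_iff by (simp add: power_mult_distrib)
  then have "int v^2 dvd (int q^2 * int u)^2" by (metis dvd_triv_left)
  then have "int v dvd int q^2 * int u" by simp
  then obtain t where "int q^2 * int u = int v * t" by (elim dvdE)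
  then have "X = t^2" using X uv(1) by (simp add: power_mult_distrib)
  moreover have "coprime M N"
  proof (rule coprimeI)
    fix d assume "d dvd M" "d dvd N"
    then have "d dvd N - M" "d dvd 3 * M - 2 * N" by simp_all
    then have "d dvd int q" "d dvd int p" by (simp_all add: M_def N_def)
    then show "is_unit d" using pq(3) by (meson coprime_common_divisor coprime_int_iff)
  qed
  moreover have "M > 0" "N > 0" using pq by (auto simp: M_def N_def)
  ultimately have "M = 1 \<and> N = 1 \<or> M = 2 \<and> N = 3"
    using binary_quartic_square_values[of M N t] by (simp add: X_def)
  then show False using pq(1) k(2) by (auto simp: M_def N_def)
qed

section \<open>Triangles of equal perimeter and area\<close>

text \<open>Here \<open>a\<close>, \<open>b\<close> enclose the angle of 60 degrees and the other triangle has legs \<open>x\<close>, \<open>x\<close> and base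
  \<open>y\<close>. The ratio \<open>k\<close> makes the equality of areas linear in \<open>y\<close>, namely \<open>s * k^2 = 3 * (s - y)\<close>, so that
  up to scale \<open>k\<close> determines \<open>y\<close>, \<open>c\<close> and the discriminant \<open>(a - b)^2\<close> of the quadratic with roots
  \<open>s - a\<close> and \<open>s - b\<close>. That this discriminant is a rational square is the equation of a curve of
  degree 6 which has a node at \<open>k = 1\<close>.\<close>

lemma equal_perimeter_area_imp_equilateral:
  fixes a b c x y :: real
  assumes rat: "a \<in> \<rat>" "b \<in> \<rat>" "c \<in> \<rat>" "y \<in> \<rat>" 
    and pos: "a > 0" "b > 0" "c > 0" "y > 0"
    and angle: "c^2 = a^2 + b^2 - a * b"
    and per: "a + b + c = 2 * x + y"
    and area: "(a + b + c) * (b + c - a) * (c + a - b) * (a + b - c) = (2 * x + y) * y * y * (2 * x - y)"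
  shows "b = a \<and> c = a \<and> x = a \<and> y = a"
proof -
  define s where "s = (a + b + c) / 2"
  have s: "a + b + c = 2 * s" "s > 0" using pos by (auto simp: s_def)
  have c: "c = 2 * s - a - b" using s by simp
  have x: "x = (2 * s - y) / 2" using per s by simp
  define k where "k = 2 * (s - c) / y"
  have k: "k * y = 2 * (s - c)" using pos by (simp add: k_def)
  have "c^2 < (a + b)^2"
    unfolding angle using mult_pos_pos[OF pos(1,2)] by (simp add: power2_eq_square algebra_simps)
  then have "c < a + b" using pos by (simp add: power2_less_imp_less)
  then have "s - c > 0" unfolding s_def by simp
  then have kpos: "k > 0" using pos by (simp add: k_def)
  (* The law of cosines in terms of the tangent lengths s - a, s - b, s - c. *)
  have tan: "3 * ((s - a) * (s - b)) = s * (s - c)" using angle unfolding c by algebra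
  have "16 * (s * ((s - a) * (s - b)) * (s - c)) = 16 * (s * (y / 2)^2 * (s - y))"
    using area unfolding x c by (simp add: power2_eq_square field_simps)
  then have "s * (3 * ((s - a) * (s - b)) * (s - c)) = s * (3 * (y / 2)^2 * (s - y))" by simp
  then have "s * (s - c)^2 = 3 * (y / 2)^2 * (s - y)"
    unfolding tan using s(2) by (simp only: power2_eq_square mult.assoc mult_cancel_left) simp
  then have "s * (2 * (s - c))^2 = 3 * y^2 * (s - y)"
    by (simp add: power_mult_distrib power_divide del: right_diff_distrib_numeral)
  then have "y^2 * (s * k^2) = y^2 * (3 * (s - y))" unfolding k[symmetric] by (simp add: power_mult_distrib mult_ac)
  then have sk: "s * k^2 = 3 * (s - y)" using pos by simp
  (* The remaining factor W^2 - 20 * W + 36 = (W - 2) * (W - 18) with W = k * (3 - k^2)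
     splits further because W - 2 has the double root k = 1 and W - 18 the root k = -3. *)
  have w: "6 * (s - c) = s * (k * (3 - k^2))" using k sk by algebra
  have "(6 * (a - b))^2 = (6 * (s - c))^2 - 20 * s * (6 * (s - c)) + 36 * s^2"
    using tan unfolding c by algebra
  also have "\<dots> = s^2 * (k - 1)^2 * ((k + 2) * (k + 3) * (k^2 - 3 * k + 6))"
    unfolding w by algebra
  finally have key: "(6 * (a - b))^2 = s^2 * (k - 1)^2 * ((k + 2) * (k + 3) * (k^2 - 3 * k + 6))" .
  have "k = 1"
  proof (rule ccontr)
    assume "k \<noteq> 1"
    then have "(k + 2) * (k + 3) * (k^2 - 3 * k + 6) = (6 * (a - b) / (s * (k - 1)))^2"
      using key s(2) by (simp add: power_divide power_mult_distrib)
    moreover have "k \<in> \<rat>" "6 * (a - b) / (s * (k - 1)) \<in> \<rat>"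
      unfolding k_def s_def using rat by auto
    ultimately show False using quartic_no_positive_rational_point kpos by blast
  qed
  then have "a = b" using key by simp
  then have "c = a" using angle pos by (simp add: power2_eq_square[symmetric] power2_eq_iff)
  then show ?thesis using \<open>a = b\<close> \<open>k = 1\<close> sk x s by auto
qed

lemma law_of_cosines_60:
  assumes "A \<noteq> B" "C \<noteq> B" "cos (vertex_angle A B C) = 1 / 2"
  shows "(dist A C)^2 = (dist A B)^2 + (dist B C)^2 - dist A B * dist B C"
proof -
  let ?q = "((A - B) \<bullet> (C - B)) / (norm (A - B) * norm (C - B))"
  have "\<bar>(A - B) \<bullet> (C - B)\<bar> \<le> norm (A - B) * norm (C - B)" by (rule Cauchy_Schwarz_ineq2)
  then have "\<bar>?q\<bar> \<le> 1" using assms by (simp add: abs_divide abs_mult divide_le_eq)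
  then have "cos (arccos ?q) = ?q" by (rule cos_arccos_abs)
  then have "?q = 1 / 2" using assms(3)[unfolded vertex_angle_def] by (rule trans[OF sym])
  then have "2 * ((A - B) \<bullet> (C - B)) = norm (A - B) * norm (C - B)"
    using assms(1,2) by (subst (asm) nonzero_divide_eq_eq) auto
  moreover have "(norm (A - C))^2 = (norm (A - B))^2 + (norm (C - B))^2 - 2 * ((A - B) \<bullet> (C - B))"
    using dot_norm_neg[of "A - B" "C - B"] by simp
  ultimately show ?thesis by (simp add: dist_norm norm_minus_commute)
qed

lemma area_heron:
  "16 * (area (A, B, C))^2 =
     (dist A B + dist B C + dist C A) * (dist B C + dist C A - dist A B) *
     (dist C A + dist A B - dist B C) * (dist A B + dist B C - dist C A)"
proof -
  define a b c where "a = dist B C" and "b = dist A C" and "c = dist A B"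
  define s where "s = (a + b + c) / 2"
  have "compact (convex hull {A, B, C})" by (intro finite_imp_compact_convex_hull) simp
  then have "convex hull {A, B, C} \<in> sets lborel" by (simp add: compact_imp_closed borel_closed)
  then have "area (A, B, C) = sqrt (s * (s - a) * (s - b) * (s - c))"
    using heron[of A B C] by (simp add: area_def solid_def a_def b_def c_def s_def)
  moreover have "s * (s - a) * (s - b) * (s - c) \<ge> 0"
    using dist_triangle[of A B C] dist_triangle[of A C B] dist_triangle[of B C A]
    by (intro mult_nonneg_nonneg) (auto simp: s_def a_def b_def c_def dist_commute)
  ultimately have "(area (A, B, C))^2 = s * (s - a) * (s - b) * (s - c)" by simp
  then show ?thesis unfolding s_def dist_commute[of C A] a_def[symmetric] b_def[symmetric] c_def[symmetric]
    by (simp add: field_simps)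
qed

text \<open>The edge vectors of the first triangle form a basis of the plane. Equal sides mean equal Gram matrices,
  so the linear map matching the edge vectors preserves norms.\<close>

lemma congruent_if_equal_sides:
  assumes "nondegenerate (A, B, C)"
    and d: "dist A B = dist A' B'" "dist B C = dist B' C'" "dist C A = dist C' A'"
  shows "congruent_triangles (A, B, C) (A', B', C')"
proof -
  define u v where "u = B - A" and "v = C - A"
  define u' v' where "u' = B' - A'" and "v' = C' - A'"
  have norms: "norm u = norm u'" "norm v = norm v'" "norm (u - v) = norm (u' - v')"
    using d by (simp_all add: u_def v_def u'_def v'_def dist_norm norm_minus_commute)
  then have inner: "u \<bullet> v = u' \<bullet> v'" by (simp add: dot_norm_neg)
  have nc: "\<not> collinear {0, u, v}"
    using assms(1) collinear_3[of B A C] unfolding nondegenerate_def u_def v_def by (simp add: insert_commute)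
  then have uv: "u \<noteq> 0" "v \<noteq> 0" "\<And>c. v \<noteq> c *\<^sub>R u" "u \<noteq> v"
    using collinear_lemma[of u v] by (auto simp: scaleR_one[symmetric] simp del: scaleR_one)
  have "v \<notin> span {u}" using uv(3) by (auto simp: span_singleton)
  then have ind: "independent {v, u}"
    using uv(1) by (simp add: independent_insert)
  then obtain g where g: "linear g" "g u = u'" "g v = v'"
    using linear_independent_extend[OF ind, of "\<lambda>x. if x = u then u' else v'"] uv(4) by auto
  have "UNIV \<subseteq> span {v, u}"
    using ind uv(4) by (intro card_ge_dim_independent) auto
  have rep: "\<exists>p q. x = p *\<^sub>R v + q *\<^sub>R u" for x
  proof -
    have "x \<in> span {v, u}" using \<open>UNIV \<subseteq> span {v, u}\<close> by auto
    then obtain p where "x - p *\<^sub>R v \<in> span {u}" using span_breakdown_eq by blast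
    then obtain q where "x - p *\<^sub>R v = q *\<^sub>R u" by (auto simp: span_singleton)
    then have "x = p *\<^sub>R v + q *\<^sub>R u" by (simp add: algebra_simps)
    then show ?thesis by blast
  qed
  have ng: "norm (g x) = norm x" for x
  proof -
    obtain p q where x: "x = p *\<^sub>R v + q *\<^sub>R u" using rep by blast
    then have gx: "g x = p *\<^sub>R v' + q *\<^sub>R u'" using g by (simp add: linear_add linear_scale)
    have "v \<bullet> v = v' \<bullet> v'" "u \<bullet> u = u' \<bullet> u'" using norms by (simp_all add: dot_square_norm)
    then have "x \<bullet> x = g x \<bullet> g x" using inner
      by (simp add: x gx[unfolded x] inner_add inner_commute)
    then show ?thesis by (simp add: norm_eq_sqrt_inner)
  qed
  define f where "f x = (A' - g A) + g x" for x
  have "dist (f x) (f y) = dist x y" for x y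
    using ng[of "x - y"] g(1) by (simp add: f_def dist_norm linear_diff)
  moreover have "f ` solid (A, B, C) = solid (A', B', C')"
  proof -
    have "f A = A'" "f B = B'" "f C = C'"
      using g by (simp_all add: f_def u_def v_def u'_def v'_def linear_diff algebra_simps)
    moreover have "f ` (convex hull {A, B, C}) = convex hull (f ` {A, B, C})"
    proof -
      have "f ` S = (\<lambda>x. (A' - g A) + x) ` g ` S" for S by (auto simp: f_def image_image)
      then show ?thesis by (simp only: convex_hull_translation convex_hull_linear_image[OF g(1)])
    qed
    ultimately show ?thesis by (simp add: solid_def)
  qed
  ultimately show ?thesis unfolding congruent_triangles_def by blast
qed

text \<open>This form allows any vertex to carry the angle and any two sides to be the equal ones; it is
  a relabelling of \<open>equal_perimeter_area_imp_equilateral\<close>.\<close>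

lemma equilateral_from_sides:
  fixes p q r p' q' r' :: real
  assumes rat: "p \<in> \<rat>" "q \<in> \<rat>" "r \<in> \<rat>" "p' \<in> \<rat>" "q' \<in> \<rat>" "r' \<in> \<rat>"
    and pos: "p > 0" "q > 0" "r > 0" "p' > 0" "q' > 0" "r' > 0"
    and angle: "q^2 = r^2 + p^2 - r * p \<or> r^2 = p^2 + q^2 - p * q \<or> p^2 = q^2 + r^2 - q * r"
    and iso: "p' = q' \<or> q' = r' \<or> r' = p'"
    and per: "p + q + r = p' + q' + r'"
    and area: "(p + q + r) * (q + r - p) * (r + p - q) * (p + q - r) =
      (p' + q' + r') * (q' + r' - p') * (r' + p' - q') * (p' + q' - r')"
  shows "p' = p \<and> q' = q \<and> r' = r"
proof -
  have *: "p' = p \<and> q' = q \<and> r' = r"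
    if "x \<in> \<rat>" "y \<in> \<rat>" "y > 0" "p + q + r = 2 * x + y" "{p', q', r'} = {x, y}"
      "(p + q + r) * (q + r - p) * (r + p - q) * (p + q - r) = (2 * x + y) * y * y * (2 * x - y)" for x y
  proof -
    have "q = p \<and> r = p \<and> x = p \<and> y = p"
      using angle
    proof (elim disjE)
      assume "q^2 = r^2 + p^2 - r * p"
      then have "p = r \<and> q = r \<and> x = r \<and> y = r" using rat pos that
        by (intro equal_perimeter_area_imp_equilateral[of r p q]) (auto simp: algebra_simps)
      then show ?thesis by simp
    next
      assume "r^2 = p^2 + q^2 - p * q"
      then show ?thesis using rat pos that
        by (intro equal_perimeter_area_imp_equilateral[of p q r]) (auto simp: algebra_simps)
    next
      assume "p^2 = q^2 + r^2 - q * r"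
      then have "r = q \<and> p = q \<and> x = q \<and> y = q" using rat pos that
        by (intro equal_perimeter_area_imp_equilateral[of q r p]) (auto simp: algebra_simps)
      then show ?thesis by simp
    qed
    then show ?thesis using that(5) by auto
  qed
  show ?thesis using iso
  proof (elim disjE)
    assume eq: "p' = q'"
    have "(p + q + r) * (q + r - p) * (r + p - q) * (p + q - r) = (2 * p' + r') * r' * r' * (2 * p' - r')"
      unfolding area eq by (simp add: mult_ac)
    then show ?thesis using rat pos per eq by (intro *[of p' r']) auto
  next
    assume eq: "q' = r'"
    have "(p + q + r) * (q + r - p) * (r + p - q) * (p + q - r) = (2 * q' + p') * p' * p' * (2 * q' - p')"
      unfolding area eq by (simp add: mult_ac)
    then show ?thesis using rat pos per eq by (intro *[of q' p']) auto
  next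
    assume eq: "r' = p'"
    have "(p + q + r) * (q + r - p) * (r + p - q) * (p + q - r) = (2 * r' + q') * q' * q' * (2 * r' - q')"
      unfolding area eq by (simp add: mult_ac)
    then show ?thesis using rat pos per eq by (intro *[of r' q']) auto
  qed
qed

theorem theorem4p2:
  shows "cos (pi / 3) = (1 / 2 :: real) \<and> \<not> (\<exists>T I. genuine_pair (1 / 2) T I)"
proof (intro conjI notI)
  show "cos (pi / 3) = (1 / 2 :: real)" by (rule cos_60)
next
  assume "\<exists>T I. genuine_pair (1 / 2) T I"
  then obtain A B C A' B' C' where "genuine_pair (1 / 2) (A, B, C) (A', B', C')" by auto
  then obtain \<theta> where nd: "nondegenerate (A, B, C)" "nondegenerate (A', B', C')"
    and rat: "rational_sides (A, B, C)" "rational_sides (A', B', C')"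
    and cos: "cos \<theta> = 1 / 2" and ang: "has_angle (A, B, C) \<theta>"
    and iso: "isosceles (A', B', C')"
    and per: "perimeter (A, B, C) = perimeter (A', B', C')"
    and area: "area (A, B, C) = area (A', B', C')"
    and not_congruent: "\<not> congruent_triangles (A, B, C) (A', B', C')"
    unfolding genuine_pair_def by blast
  have ne: "A \<noteq> B" "B \<noteq> C" "C \<noteq> A" "A' \<noteq> B'" "B' \<noteq> C'" "C' \<noteq> A'"
    using nd by (auto simp: nondegenerate_def insert_commute)
  have angle: "(dist B C)^2 = (dist C A)^2 + (dist A B)^2 - dist C A * dist A B \<or>
    (dist C A)^2 = (dist A B)^2 + (dist B C)^2 - dist A B * dist B C \<or>
    (dist A B)^2 = (dist B C)^2 + (dist C A)^2 - dist B C * dist C A"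
    using ang law_of_cosines_60[of C A B] law_of_cosines_60[of A B C] law_of_cosines_60[of B C A] cos ne
    unfolding has_angle_def by (auto simp: dist_commute)
  have "dist A' B' = dist A B \<and> dist B' C' = dist B C \<and> dist C' A' = dist C A"
  proof (rule equilateral_from_sides[OF _ _ _ _ _ _ _ _ _ _ _ _ angle])
    show "(dist A B + dist B C + dist C A) * (dist B C + dist C A - dist A B) *
        (dist C A + dist A B - dist B C) * (dist A B + dist B C - dist C A) =
      (dist A' B' + dist B' C' + dist C' A') * (dist B' C' + dist C' A' - dist A' B') *
        (dist C' A' + dist A' B' - dist B' C') * (dist A' B' + dist B' C' - dist C' A')"
      unfolding area_heron[symmetric] area ..
  qed (use rat ne iso per in \<open>auto simp: rational_sides_def isosceles_def perimeter_def\<close>)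
  then show False using congruent_if_equal_sides[OF nd(1)] not_congruent by simp
qed

end
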